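(* Let $(Z_n)_{n\ge1}$ be a sequence of nonnegative random variables on a common probability space such that $Z_n=\Omega_p(n^{-1})$. Then $\mathbb P\bigl(\sum_{n=1}^\infty Z_n=\infty\bigr)=1$.
   Context: For random variables $(X_n)$ and a nonrandom positive sequence $(a_n)$, $X_n=\Omega_p(a_n)$ means: for every $\varepsilon>0$ there exists $\delta>0$ such that $\mathbb P(|X_n|\ge\delta a_n)\ge1-\varepsilon$ for all but finitely many $n$. *)

theory Defs
  imports "HOL-Probability.Probability"
begin

text \<open>
  \<open>X n = \<Omega>\<^sub>p(a n)\<close>.  The notion is meant for random variables \<open>X n\<close> and a deterministic
  sequence \<open>a n\<close> that is positive at all indices of interest; since only large \<open>n\<close> matter,
  sequences indexed from 1 are accommodated by ignoring index 0.
\<close>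

definition Omega_p :: "'a measure \<Rightarrow> (nat \<Rightarrow> 'a \<Rightarrow> real) \<Rightarrow> (nat \<Rightarrow> real) \<Rightarrow> bool" where
  "Omega_p M X a \<longleftrightarrow>
     (\<forall>\<epsilon>>0. \<exists>\<delta>>0. \<forall>\<^sub>F n in sequentially.
        measure M {\<omega> \<in> space M. \<bar>X n \<omega>\<bar> \<ge> \<delta> * a n} \<ge> 1 - \<epsilon>)"

end

theory Submission
  imports Defs
begin

text \<open>
  If the sum converges with positive probability, then it is bounded by a constant \<open>K\<close> on an
  event \<open>B\<close> of positive probability \<open>q\<close>.  Taking \<open>\<epsilon> = q / 2\<close>, the event \<open>Z n \<ge> \<delta> / n\<close> meets \<open>B\<close>
  in probability at least \<open>q / 2\<close> for large \<open>n\<close>, so the integral of the sum over \<open>B\<close> dominates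
  a tail of the harmonic series, although it is at most \<open>K\<close>.
\<close>

text \<open>Shifting the index discards \<open>Z 0\<close>, about which the theorem assumes neither
  measurability nor nonnegativity, so that the lemmas below can require both for every
  index.\<close>

lemma Omega_p_Suc:
  assumes "Omega_p M X a"
  shows "Omega_p M (\<lambda>n. X (Suc n)) (\<lambda>n. a (Suc n))"
  unfolding Omega_p_def
proof (intro allI impI)
  fix \<epsilon> :: real assume "\<epsilon> > 0"
  with assms obtain \<delta> where "\<delta> > 0"
    and "\<forall>\<^sub>F n in sequentially. measure M {\<omega> \<in> space M. \<bar>X n \<omega>\<bar> \<ge> \<delta> * a n} \<ge> 1 - \<epsilon>"
    unfolding Omega_p_def by blast
  then show "\<exists>\<delta>>0. \<forall>\<^sub>F n in sequentially.
      measure M {\<omega> \<in> space M. \<bar>X (Suc n) \<omega>\<bar> \<ge> \<delta> * a (Suc n)} \<ge> 1 - \<epsilon>"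
    by (auto dest: eventually_compose_filterlim[OF _ filterlim_Suc])
qed

context prob_space
begin

lemma Omega_p_nonsummable_bounded_null:
  fixes X :: "nat \<Rightarrow> 'a \<Rightarrow> real" and a :: "nat \<Rightarrow> real" and K :: nat
  assumes meas [measurable]: "\<And>n. X n \<in> borel_measurable M"
    and nonneg: "\<And>n \<omega>. \<omega> \<in> space M \<Longrightarrow> X n \<omega> \<ge> 0"
    and a: "\<And>n. a n \<ge> 0" "\<not> summable a"
    and Omega: "Omega_p M X a"
  shows "prob {\<omega> \<in> space M. (\<Sum>n. ennreal (X n \<omega>)) \<le> of_nat K} = 0"
proof (rule ccontr)
  define B where "B = {\<omega> \<in> space M. (\<Sum>n. ennreal (X n \<omega>)) \<le> of_nat K}"
  define q where "q = prob B"
  have B [measurable]: "B \<in> sets M"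
    unfolding B_def by measurable
  assume "prob {\<omega> \<in> space M. (\<Sum>n. ennreal (X n \<omega>)) \<le> of_nat K} \<noteq> 0"
  then have "q > 0"
    unfolding q_def B_def by (simp add: zero_less_measure_iff)
  then obtain \<delta> N where \<delta>: "\<delta> > 0"
    and N: "\<And>n. n \<ge> N \<Longrightarrow> prob {\<omega> \<in> space M. \<bar>X n \<omega>\<bar> \<ge> \<delta> * a n} \<ge> 1 - q / 2"
    using Omega unfolding Omega_p_def eventually_sequentially by (meson half_gt_zero)
  \<comment> \<open>Lower bound for the integral of \<open>X n\<close> over \<open>B\<close>: height
    \<open>\<delta> * a n\<close> times probability \<open>q / 2\<close>. It is 0 before
    \<open>N\<close>, where no probability estimate is available, so that the bound holds for all
    \<open>n\<close> and whole series can be compared.\<close>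
  define c where "c n = (if n \<ge> N then \<delta> * (q / 2) * a n else 0)" for n
  have c_nonneg: "c n \<ge> 0" for n
    using \<delta> \<open>q > 0\<close> a(1) by (simp add: c_def)
  have c_le: "ennreal (c n) \<le> (\<integral>\<^sup>+\<omega>. ennreal (X n \<omega>) * indicator B \<omega> \<partial>M)" for n
  proof (cases "n \<ge> N")
    case True
    define E where "E = {\<omega> \<in> space M. \<bar>X n \<omega>\<bar> \<ge> \<delta> * a n}"
    have E [measurable]: "E \<in> sets M"
      unfolding E_def by measurable
    \<comment> \<open>Inclusion-exclusion: the intersection has probability at least (1 - q/2) + q -
      1 = q/2.\<close>
    have "prob E + q = prob (E \<union> B) + prob (E \<inter> B)"
      unfolding q_def using measure_Un3[of E M B] by (simp add: fmeasurable_eq_sets)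
    then have "prob (E \<inter> B) \<ge> q / 2"
      using N[OF True] prob_le_1[of "E \<union> B"] unfolding E_def[symmetric] by linarith
    then have "c n \<le> \<delta> * a n * prob (E \<inter> B)"
      using True \<delta> a(1)[of n] mult_left_mono[of "q / 2" "prob (E \<inter> B)" "\<delta> * a n"]
      by (simp add: c_def mult_ac)
    then have "ennreal (c n) \<le> ennreal (\<delta> * a n) * emeasure M (E \<inter> B)"
      using \<delta> a(1)[of n] by (simp add: emeasure_eq_measure flip: ennreal_mult)
    also have "\<dots> = (\<integral>\<^sup>+\<omega>. ennreal (\<delta> * a n) * indicator (E \<inter> B) \<omega> \<partial>M)"
      by (simp add: nn_integral_cmult_indicator)
    also have "\<dots> \<le> (\<integral>\<^sup>+\<omega>. ennreal (X n \<omega>) * indicator B \<omega> \<partial>M)"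
      by (rule nn_integral_mono)
        (use nonneg in \<open>auto simp: E_def indicator_def intro!: ennreal_leI\<close>)
    finally show ?thesis .
  qed (simp add: c_def)
  have "(\<Sum>n. ennreal (c n)) \<le> (\<Sum>n. \<integral>\<^sup>+\<omega>. ennreal (X n \<omega>) * indicator B \<omega> \<partial>M)"
    by (intro suminf_le c_le) auto
  also have "\<dots> = (\<integral>\<^sup>+\<omega>. (\<Sum>n. ennreal (X n \<omega>) * indicator B \<omega>) \<partial>M)"
    by (rule nn_integral_suminf[symmetric]) measurable
  \<comment> \<open>The series is at most \<open>K\<close> on \<open>B\<close> by choice of
    \<open>B\<close>, and it vanishes off \<open>B\<close>.\<close>
  also have "\<dots> \<le> (\<integral>\<^sup>+\<omega>. of_nat K \<partial>M)"
    by (rule nn_integral_mono) (auto simp: B_def indicator_def)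
  also have "\<dots> < \<infinity>"
    by (simp add: emeasure_space_1 of_nat_less_top)
  finally have "summable c"
    by (intro summable_suminf_not_top c_nonneg) auto
  \<comment> \<open>Finitely many terms do not affect summability, and the positive factor cancels,
    so \<open>a\<close> itself would be summable.\<close>
  moreover have "\<forall>\<^sub>F n in sequentially. c n = \<delta> * (q / 2) * a n"
    using eventually_ge_at_top[of N] by eventually_elim (simp add: c_def)
  ultimately have "summable (\<lambda>n. \<delta> * (q / 2) * a n)"
    by (simp add: summable_cong)
  then show False
    using a(2) \<delta> \<open>q > 0\<close> by (simp add: summable_cmult_iff)
qed

text \<open>A finite value in \<open>ennreal\<close> lies below some natural number. Hence the event
  of a finite sum is the union of the null events for natural bounds \<open>K\<close>, and this
  union is countable.\<close>

lemma Omega_p_nonsummable_AE_infinite: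
  fixes X :: "nat \<Rightarrow> 'a \<Rightarrow> real" and a :: "nat \<Rightarrow> real"
  assumes meas [measurable]: "\<And>n. X n \<in> borel_measurable M"
    and "\<And>n \<omega>. \<omega> \<in> space M \<Longrightarrow> X n \<omega> \<ge> 0"
    and "\<And>n. a n \<ge> 0" "\<not> summable a"
    and "Omega_p M X a"
  shows "AE \<omega> in M. (\<Sum>n. ennreal (X n \<omega>)) = \<infinity>"
proof -
  have "AE \<omega> in M. \<not> (\<Sum>n. ennreal (X n \<omega>)) \<le> of_nat K" for K
    using Omega_p_nonsummable_bounded_null[OF assms, of K]
    by (subst AE_iff_measurable[OF _ refl]) (auto simp: emeasure_eq_measure)
  then have "AE \<omega> in M. \<forall>K. \<not> (\<Sum>n. ennreal (X n \<omega>)) \<le> of_nat K"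
    by (simp add: AE_all_countable)
  then show ?thesis
  proof eventually_elim
    case (elim \<omega>)
    then show ?case
      using ennreal_Ex_less_of_nat[of "\<Sum>n. ennreal (X n \<omega>)"]
      by (metis infinity_ennreal_def less_imp_le less_top)
  qed
qed

end

theorem theorem2p2:
  fixes M :: "'a measure" and Z :: "nat \<Rightarrow> 'a \<Rightarrow> real"
  assumes "prob_space M"
    and "\<And>n. n \<ge> 1 \<Longrightarrow> Z n \<in> borel_measurable M"
    and "\<And>n \<omega>. n \<ge> 1 \<Longrightarrow> \<omega> \<in> space M \<Longrightarrow> Z n \<omega> \<ge> 0"
    and "Omega_p M Z (\<lambda>n. inverse (real n))"
  shows "measure M {\<omega> \<in> space M. (\<Sum>n. ennreal (Z (Suc n) \<omega>)) = \<infinity>} = 1"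
proof -
  interpret prob_space M by fact
  have [measurable]: "Z (Suc n) \<in> borel_measurable M" for n
    using assms(2) by simp
  have "\<not> summable (\<lambda>n. inverse (real (Suc n)))"
    using not_summable_harmonic[where 'a = real]
    by (subst summable_Suc_iff[of "\<lambda>n. inverse (real n)"])
  then have "AE \<omega> in M. (\<Sum>n. ennreal (Z (Suc n) \<omega>)) = \<infinity>"
    using assms(3) Omega_p_Suc[OF assms(4)]
    by (intro Omega_p_nonsummable_AE_infinite[of _ "\<lambda>n. inverse (real (Suc n))"]) auto
  then show ?thesis
    by (subst prob_Collect_eq_1) auto
qed

end
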